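(* Let $\Gamma$ be a lattice in $\mathrm{SL}_d(\mathbb{R})$. Then, given a polynomial representation $\rho:\mathrm{SL}_d(\mathbb{R})\to\mathrm{GL}_N(\mathbb{C})$, every vector $v\in\mathbb{C}^N$ which is fixed by $\rho(\Gamma)$ is also fixed by $\rho(\mathrm{SL}_d(\mathbb{R}))$.
   Context: A discrete subgroup $\Gamma$ of a Lie group $G$ is called a lattice if $\Gamma\backslash G$ has finite measure with respect to the measure induced from the left-invariant (Haar) measure $m$ on $G$, i.e. $m(F)<\infty$ for a Borel set $F$ with $G=\bigsqcup_{\gamma\in\Gamma}\gamma F$. A polynomial representation is a group homomorphism $\rho$ such that the matrix entries of $\rho(g)$ are polynomial functions (with complex coefficients) of the matrix entries of $g$. *)

theory Defs
  imports "HOL-Analysis.Analysis" "HOL-Algebra.Coset"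
begin

definition SL :: "('k::field ^ 'n ^ 'n) monoid"
  where "SL = \<lparr>carrier = {A. det A = 1}, mult = (**), one = mat 1\<rparr>"

definition GL :: "('k::field ^ 'n ^ 'n) monoid"
  where "GL = \<lparr>carrier = {A. invertible A}, mult = (**), one = mat 1\<rparr>"

lemma group_SL: "group (SL :: ('k::field ^ 'n ^ 'n) monoid)"
proof (rule groupI)
  fix A :: "'k ^ 'n ^ 'n" assume A: "A \<in> carrier SL"
  then have "invertible A" by (simp add: SL_def invertible_det_nz)
  then obtain B where B: "B ** A = mat 1" by (auto simp: invertible_def)
  have "det B * det A = 1" by (metis B det_I det_mul)
  with A have "B \<in> carrier SL" by (simp add: SL_def)
  with B show "\<exists>y\<in>carrier SL. y \<otimes>\<^bsub>SL\<^esub> A = \<one>\<^bsub>SL\<^esub>" by (auto simp: SL_def)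
qed (auto simp: SL_def det_mul matrix_mul_assoc)

lemma group_GL: "group (GL :: ('k::field ^ 'n ^ 'n) monoid)"
proof (rule groupI)
  fix A :: "'k ^ 'n ^ 'n" assume "A \<in> carrier GL"
  then show "\<exists>y\<in>carrier GL. y \<otimes>\<^bsub>GL\<^esub> A = \<one>\<^bsub>GL\<^esub>" by (auto simp: GL_def invertible_def)
next
  show "\<one>\<^bsub>GL\<^esub> \<in> carrier (GL :: ('k ^ 'n ^ 'n) monoid)"
    by (auto simp: GL_def invertible_def intro: exI[of _ "mat 1"])
qed (auto simp: GL_def invertible_mult matrix_mul_assoc)

text \<open>
  Intended for groups whose carrier, with the subspace topology, is a second countable locally
  compact topological group (in particular for matrix Lie groups). A Borel measure on
  such a space that is finite on compact sets is automatically a Radon measure, so no regularity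
  condition is imposed.
\<close>

definition left_haar_measure :: "('a::second_countable_topology, 'b) monoid_scheme \<Rightarrow> 'a measure \<Rightarrow> bool"
  where "left_haar_measure G m \<longleftrightarrow>
    sets m = sets (restrict_space borel (carrier G)) \<and>
    (\<forall>g\<in>carrier G. \<forall>A\<in>sets m. emeasure m (g <#\<^bsub>G\<^esub> A) = emeasure m A) \<and>
    (\<forall>K. compact K \<and> K \<subseteq> carrier G \<longrightarrow> emeasure m K < \<infinity>) \<and>
    emeasure m (carrier G) \<noteq> 0"

text \<open>
  As a left Haar measure is unique up to a positive scalar, it does not matter which one is chosen.
\<close>

definition discrete_lattice :: "('a::second_countable_topology, 'b) monoid_scheme \<Rightarrow> 'a set \<Rightarrow> bool"
  where "discrete_lattice G \<Gamma> \<longleftrightarrow>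
    subgroup \<Gamma> G \<and> discrete \<Gamma> \<and>
    (\<exists>m F. left_haar_measure G m \<and> F \<in> sets m \<and>
       carrier G = (\<Union>\<gamma>\<in>\<Gamma>. \<gamma> <#\<^bsub>G\<^esub> F) \<and>
       disjoint_family_on (\<lambda>\<gamma>. \<gamma> <#\<^bsub>G\<^esub> F) \<Gamma> \<and>
       emeasure m F < \<infinity>)"

text \<open>
  A polynomial in the entries \<open>g $ i $ j\<close> is written as a finite sum of monomials; the exponent
  function \<open>\<alpha>\<close> gives the exponent \<open>\<alpha> i j\<close> of the variable \<open>g $ i $ j\<close>.
\<close>

definition polynomial_in_entries_on ::
    "(real ^ 'n ^ 'n) set \<Rightarrow> (real ^ 'n ^ 'n \<Rightarrow> complex) \<Rightarrow> bool"
  where "polynomial_in_entries_on X f \<longleftrightarrow>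
    (\<exists>(S :: ('n \<Rightarrow> 'n \<Rightarrow> nat) set) (c :: ('n \<Rightarrow> 'n \<Rightarrow> nat) \<Rightarrow> complex). finite S \<and>
       (\<forall>g\<in>X. f g = (\<Sum>\<alpha>\<in>S. c \<alpha> * (\<Prod>i\<in>UNIV. \<Prod>j\<in>UNIV. complex_of_real (g $ i $ j) ^ \<alpha> i j))))"

definition polynomial_representation_SL :: "(real ^ 'd ^ 'd \<Rightarrow> complex ^ 'N ^ 'N) \<Rightarrow> bool"
  where "polynomial_representation_SL \<rho> \<longleftrightarrow>
    \<rho> \<in> hom SL GL \<and>
    (\<forall>i j. polynomial_in_entries_on (carrier SL) (\<lambda>g. \<rho> g $ i $ j))"

end

theory Submission
  imports Defs "HOL-Algebra.Generated_Groups" "HOL-Computational_Algebra.Fundamental_Theorem_Algebra"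
begin

text \<open>
  Write \<open>G\<close> for the special linear group. As \<open>v\<close> is fixed by \<open>\<Gamma>\<close>, the orbit map
  \<open>\<phi> g = \<rho> (g\<^sup>-\<^sup>1) v\<close> is a function on \<open>\<Gamma>\G\<close>. Right translation by the powers of a transvection
  \<open>1 + t e\<^sub>i\<^sub>j\<close> moves \<open>\<phi> g\<close> along a curve whose coordinates are polynomials in \<open>t\<close>. Such a curve is constant or
  tends to infinity in norm (\<open>polynomial_vector_curve_dichotomy\<close>). If right translations preserve the
  finite measure on \<open>\<Gamma>\G\<close>, then Poincare recurrence allows escape to infinity only on a null set
  (\<open>no_escape_to_infinity\<close>). So there is a \<open>g\<close>, indeed almost every \<open>g\<close>, such that \<open>\<phi> g\<close> is fixed by
  all transvections. These generate \<open>G\<close> (\<open>SL_generated_by_transvections\<close>), hence \<open>\<phi> g\<close> is fixed by \<open>G\<close>; applying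
  \<open>\<rho> g\<close> gives \<open>v = \<phi> g\<close>, and \<open>v\<close> itself is fixed by \<open>G\<close>.

  The given Haar measure \<open>m\<close> is only left-invariant, while the argument needs right invariance. The
  lattice itself provides it. All fundamental domains of \<open>\<Gamma>\<close> have the same measure, so
  \<open>m(F h) = m(F)\<close> for every \<open>h\<close>. With this, Fubini's theorem on \<open>G \<times> G\<close> shows
  \<open>m(F) m(C\<^sup>-\<^sup>1) = m(F) m(C)\<close> for every measurable \<open>C\<close> (\<open>emeasure_inverse\<close>). Since \<open>0 < m(F) < \<infinity>\<close>,
  inversion preserves \<open>m\<close>, and left invariance turns into right invariance.
\<close>

section \<open>Groups with a fundamental domain of finite measure\<close>

text \<open>
  The measure-theoretic situation, stripped of topology: measurability of the group operations is
  all that Fubini's theorem needs, and \<open>F\<close> with the restriction of \<open>m\<close> stands for the quotient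
  \<open>\<Gamma>\G\<close>. Only left invariance of \<open>m\<close> is assumed; right invariance is derived below.
\<close>

locale group_with_fundamental_domain = group G for G :: "('a, 'b) monoid_scheme" (structure) +
  fixes m :: "'a measure" and \<Gamma> F :: "'a set"
  assumes space_m: "space m = carrier G"
    and mult_measurable: "(\<lambda>(x, y). x \<otimes> y) \<in> m \<Otimes>\<^sub>M m \<rightarrow>\<^sub>M m"
    and inv_measurable [measurable]: "(\<lambda>x. inv x) \<in> m \<rightarrow>\<^sub>M m"
    and left_invariant: "\<And>g A. g \<in> carrier G \<Longrightarrow> A \<in> sets m \<Longrightarrow> emeasure m (g <# A) = emeasure m A"
    and nonzero: "emeasure m (carrier G) \<noteq> 0"
    and \<Gamma>_subgroup: "subgroup \<Gamma> G"
    and \<Gamma>_countable: "countable \<Gamma>"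
    and F_sets: "F \<in> sets m"
    and F_cover: "carrier G = (\<Union>\<gamma>\<in>\<Gamma>. \<gamma> <# F)"
    and F_disjoint: "disjoint_family_on (\<lambda>\<gamma>. \<gamma> <# F) \<Gamma>"
    and F_finite: "emeasure m F < \<infinity>"
begin

lemma sets_into_carrier: "A \<in> sets m \<Longrightarrow> A \<subseteq> carrier G"
  using sets.sets_into_space space_m by blast

lemma mult_measurable' [measurable (raw)]:
  assumes "f \<in> M \<rightarrow>\<^sub>M m" "g \<in> M \<rightarrow>\<^sub>M m"
  shows "(\<lambda>x. f x \<otimes> g x) \<in> M \<rightarrow>\<^sub>M m"
  using measurable_compose[OF measurable_Pair[OF assms] mult_measurable] by simp

lemma const_measurable [measurable]: "g \<in> carrier G \<Longrightarrow> (\<lambda>x. g) \<in> M \<rightarrow>\<^sub>M m"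
  by (simp add: space_m)

lemma l_coset_vimage:
  assumes "g \<in> carrier G" "A \<subseteq> carrier G"
  shows "g <# A = {x \<in> carrier G. inv g \<otimes> x \<in> A}"
  using assms by (force simp: l_coset_def m_assoc[symmetric] subset_iff)

lemma r_coset_vimage:
  assumes "g \<in> carrier G" "A \<subseteq> carrier G"
  shows "A #> g = {x \<in> carrier G. x \<otimes> inv g \<in> A}"
  using assms by (force simp: r_coset_def m_assoc subset_iff)

lemma l_coset_sets [measurable]:
  assumes "g \<in> carrier G" "A \<in> sets m" shows "g <# A \<in> sets m"
  unfolding l_coset_vimage[OF assms(1) sets_into_carrier[OF assms(2)]] space_m[symmetric]
  using assms by measurable

lemma r_coset_sets [measurable]:
  assumes "g \<in> carrier G" "A \<in> sets m" shows "A #> g \<in> sets m"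
  unfolding r_coset_vimage[OF assms(1) sets_into_carrier[OF assms(2)]] space_m[symmetric]
  using assms by measurable

lemma emeasure_left_mult_vimage:
  assumes "g \<in> carrier G" "A \<in> sets m"
  shows "emeasure m {x \<in> carrier G. g \<otimes> x \<in> A} = emeasure m A"
  using left_invariant[of "inv g" A] l_coset_vimage[of "inv g" A] assms sets_into_carrier by simp

definition fundamental :: "'a set \<Rightarrow> bool" where
  "fundamental D \<longleftrightarrow> D \<in> sets m \<and> carrier G = (\<Union>\<gamma>\<in>\<Gamma>. \<gamma> <# D) \<and> disjoint_family_on (\<lambda>\<gamma>. \<gamma> <# D) \<Gamma>"

text \<open>
  These are the preimages of subsets of the quotient \<open>\<Gamma>\G\<close>.
\<close>

definition left_periodic :: "'a set \<Rightarrow> bool" where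
  "left_periodic A \<longleftrightarrow> A \<subseteq> carrier G \<and> (\<forall>\<gamma>\<in>\<Gamma>. \<forall>x\<in>A. \<gamma> \<otimes> x \<in> A)"

lemma \<Gamma>_carrier: "\<gamma> \<in> \<Gamma> \<Longrightarrow> \<gamma> \<in> carrier G"
  using subgroup.mem_carrier[OF \<Gamma>_subgroup] .

lemma \<Gamma>_inv: "\<gamma> \<in> \<Gamma> \<Longrightarrow> inv \<gamma> \<in> \<Gamma>"
  using subgroup.m_inv_closed[OF \<Gamma>_subgroup] .

lemma left_periodic_iff:
  assumes "left_periodic A" "\<gamma> \<in> \<Gamma>" "x \<in> carrier G"
  shows "\<gamma> \<otimes> x \<in> A \<longleftrightarrow> x \<in> A"
proof
  assume "\<gamma> \<otimes> x \<in> A"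
  then have "inv \<gamma> \<otimes> (\<gamma> \<otimes> x) \<in> A"
    using assms \<Gamma>_inv unfolding left_periodic_def by blast
  then show "x \<in> A" using assms \<Gamma>_carrier by (simp add: m_assoc[symmetric])
qed (use assms in \<open>auto simp: left_periodic_def\<close>)

lemma fundamental_F: "fundamental F"
  unfolding fundamental_def using F_sets F_cover F_disjoint by blast

lemma fundamental_r_coset:
  assumes "fundamental D" "h \<in> carrier G"
  shows "fundamental (D #> h)"
proof -
  have D: "D \<subseteq> carrier G"
    using assms(1) sets_into_carrier unfolding fundamental_def by blast
  have *: "\<gamma> <# (D #> h) = (\<gamma> <# D) #> h" if "\<gamma> \<in> \<Gamma>" for \<gamma>
    using D assms(2) \<Gamma>_carrier[OF that]
    by (auto simp: l_coset_def r_coset_def m_assoc subset_iff)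
  have "(\<Union>\<gamma>\<in>\<Gamma>. \<gamma> <# (D #> h)) = (\<Union>\<gamma>\<in>\<Gamma>. \<gamma> <# D) #> h"
    using * by (auto simp: r_coset_def)
  also have "\<dots> = carrier G #> h" using assms(1) by (simp add: fundamental_def)
  also have "\<dots> = carrier G" using assms(2) r_coset_vimage[of h "carrier G"] by auto
  finally have cover: "carrier G = (\<Union>\<gamma>\<in>\<Gamma>. \<gamma> <# (D #> h))" ..
  have "disjoint_family_on (\<lambda>\<gamma>. \<gamma> <# (D #> h)) \<Gamma>"
    unfolding disjoint_family_on_def
  proof (intro ballI impI)
    fix a b assume ab: "a \<in> \<Gamma>" "b \<in> \<Gamma>" "a \<noteq> b"
    have sub: "a <# D \<subseteq> carrier G" "b <# D \<subseteq> carrier G"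
      using D ab \<Gamma>_carrier by (auto simp: l_coset_subset_G)
    have "(a <# D) \<inter> (b <# D) = {}"
      using assms(1) ab by (auto simp: fundamental_def disjoint_family_on_def)
    then show "(a <# (D #> h)) \<inter> (b <# (D #> h)) = {}"
      using ab by (auto simp: * r_coset_vimage[OF assms(2) sub(1)] r_coset_vimage[OF assms(2) sub(2)])
  qed
  then show ?thesis
    using cover assms r_coset_sets unfolding fundamental_def by blast
qed

lemma emeasure_fundamental_eq_sum:
  assumes D: "fundamental D" and A: "A \<in> sets m"
  shows "emeasure m A = (\<integral>\<^sup>+\<gamma>. emeasure m (A \<inter> (\<gamma> <# D)) \<partial>count_space \<Gamma>)"
proof -
  have "A = A \<inter> (\<Union>\<gamma>\<in>\<Gamma>. \<gamma> <# D)"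
    using D sets_into_carrier[OF A] by (auto simp: fundamental_def)
  then have "A = (\<Union>\<gamma>\<in>\<Gamma>. A \<inter> (\<gamma> <# D))" by auto
  then have "emeasure m A = emeasure m (\<Union>\<gamma>\<in>\<Gamma>. A \<inter> (\<gamma> <# D))" by simp
  also have "\<dots> = (\<integral>\<^sup>+\<gamma>. emeasure m (A \<inter> (\<gamma> <# D)) \<partial>count_space \<Gamma>)"
  proof (rule emeasure_UN_countable)
    show "A \<inter> (\<gamma> <# D) \<in> sets m" if "\<gamma> \<in> \<Gamma>" for \<gamma>
      using that D A \<Gamma>_carrier by (auto simp: fundamental_def)
    show "disjoint_family_on (\<lambda>\<gamma>. A \<inter> (\<gamma> <# D)) \<Gamma>"
      using D unfolding fundamental_def disjoint_family_on_def by blast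
  qed (rule \<Gamma>_countable)
  finally show ?thesis .
qed

text \<open>
  The quotient measure of \<open>\<Gamma>\A\<close> may be computed on any fundamental domain: cut \<open>A \<inter> D\<close> along the
  translates of \<open>E\<close>, move the piece in \<open>\<gamma>\<^sup>-\<^sup>1E\<close> by \<open>\<gamma>\<close>, and recognise the pieces into which the translates
  of \<open>D\<close> cut \<open>A \<inter> E\<close>.
\<close>

lemma emeasure_fundamental_independent:
  assumes D: "fundamental D" and E: "fundamental E" and A: "A \<in> sets m" "left_periodic A"
  shows "emeasure m (A \<inter> D) = emeasure m (A \<inter> E)"
proof -
  have sets: "D \<in> sets m" "E \<in> sets m" using D E by (auto simp: fundamental_def)
  have bij: "bij_betw (\<lambda>\<gamma>. inv \<gamma>) \<Gamma> \<Gamma>"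
    by (rule bij_betw_byWitness[where f' = "\<lambda>\<gamma>. inv \<gamma>"]) (auto simp: \<Gamma>_inv \<Gamma>_carrier)
  have shift: "emeasure m (A \<inter> D \<inter> (inv \<gamma> <# E)) = emeasure m (A \<inter> E \<inter> (\<gamma> <# D))" if \<gamma>: "\<gamma> \<in> \<Gamma>" for \<gamma>
  proof -
    have "emeasure m (A \<inter> D \<inter> (inv \<gamma> <# E)) = emeasure m (\<gamma> <# (A \<inter> D \<inter> (inv \<gamma> <# E)))"
      using \<gamma> sets A \<Gamma>_carrier by (intro left_invariant[symmetric]) auto
    also have "\<gamma> <# (A \<inter> D \<inter> (inv \<gamma> <# E)) = A \<inter> E \<inter> (\<gamma> <# D)"
      using \<gamma> sets[THEN sets_into_carrier] A(1)[THEN sets_into_carrier] \<Gamma>_carrier[OF \<gamma>] \<Gamma>_inv[OF \<gamma>]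
        left_periodic_iff[OF A(2) \<Gamma>_inv[OF \<gamma>]]
      by (subst (1 2 3) l_coset_vimage) (auto simp: m_assoc[symmetric] l_coset_vimage)
    finally show ?thesis .
  qed
  have "emeasure m (A \<inter> D) = (\<integral>\<^sup>+\<gamma>. emeasure m (A \<inter> D \<inter> (\<gamma> <# E)) \<partial>count_space \<Gamma>)"
    using sets A by (intro emeasure_fundamental_eq_sum[OF E]) auto
  also have "\<dots> = (\<integral>\<^sup>+\<gamma>. emeasure m (A \<inter> D \<inter> (inv \<gamma> <# E)) \<partial>count_space \<Gamma>)"
    using nn_integral_bij_count_space[OF bij] by (rule sym)
  also have "\<dots> = (\<integral>\<^sup>+\<gamma>. emeasure m (A \<inter> E \<inter> (\<gamma> <# D)) \<partial>count_space \<Gamma>)"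
    by (rule nn_integral_cong) (simp add: shift)
  also have "\<dots> = emeasure m (A \<inter> E)"
    using sets A by (intro emeasure_fundamental_eq_sum[OF D, symmetric]) auto
  finally show ?thesis .
qed

lemma left_periodic_carrier: "left_periodic (carrier G)"
  by (auto simp: left_periodic_def \<Gamma>_carrier)

text \<open>
  Right translation may a priori change \<open>m\<close> by a modular factor, but \<open>F h\<close> is again a fundamental domain
  of the same \<open>\<Gamma>\<close>. Here the lattice enters the proof of right invariance.
\<close>

lemma emeasure_fundamental_r_coset:
  assumes "h \<in> carrier G"
  shows "emeasure m (F #> h) = emeasure m F"
proof -
  have "F \<subseteq> carrier G" "F #> h \<subseteq> carrier G"
    using assms F_sets r_coset_sets sets_into_carrier by auto
  then show ?thesis
    using emeasure_fundamental_independent[OF fundamental_r_coset[OF fundamental_F assms] fundamental_F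
       _ left_periodic_carrier] space_m
    by (metis inf.absorb_iff2 sets.top)
qed

lemma emeasure_F_nonzero: "emeasure m F \<noteq> 0"
proof
  assume F: "emeasure m F = 0"
  have "emeasure m (carrier G) = (\<integral>\<^sup>+\<gamma>. emeasure m (carrier G \<inter> (\<gamma> <# F)) \<partial>count_space \<Gamma>)"
    using emeasure_fundamental_eq_sum[OF fundamental_F] space_m by (metis sets.top)
  also have "\<dots> = (\<integral>\<^sup>+\<gamma>. 0 \<partial>count_space \<Gamma>)"
  proof (rule nn_integral_cong)
    fix \<gamma> assume "\<gamma> \<in> space (count_space \<Gamma>)"
    then have \<gamma>: "\<gamma> \<in> carrier G" by (simp add: \<Gamma>_carrier)
    have "emeasure m (carrier G \<inter> (\<gamma> <# F)) \<le> emeasure m (\<gamma> <# F)"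
      using \<gamma> F_sets by (intro emeasure_mono) auto
    then show "emeasure m (carrier G \<inter> (\<gamma> <# F)) = 0"
      using left_invariant[OF \<gamma> F_sets] F by simp
  qed
  finally show False using nonzero by simp
qed

sublocale sigma_finite_measure m
proof
  have "\<gamma> <# F \<in> sets m \<and> emeasure m (\<gamma> <# F) \<noteq> \<infinity>" if "\<gamma> \<in> \<Gamma>" for \<gamma>
    using left_invariant[OF \<Gamma>_carrier[OF that] F_sets] F_finite F_sets \<Gamma>_carrier[OF that] by auto
  then show "\<exists>A. countable A \<and> A \<subseteq> sets m \<and> \<Union>A = space m \<and> (\<forall>a\<in>A. emeasure m a \<noteq> \<infinity>)"
    using F_cover \<Gamma>_countable space_m by (intro exI[of _ "(\<lambda>\<gamma>. \<gamma> <# F) ` \<Gamma>"]) auto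
qed

lemma distr_left_mult:
  assumes "g \<in> carrier G"
  shows "distr m m (\<lambda>x. g \<otimes> x) = m"
proof (rule measure_eqI)
  fix A assume "A \<in> sets (distr m m (\<lambda>x. g \<otimes> x))"
  then show "emeasure (distr m m (\<lambda>x. g \<otimes> x)) A = emeasure m A"
    using assms emeasure_left_mult_vimage[OF assms, of A]
    by (simp add: emeasure_distr vimage_def Int_def space_m conj_commute)
qed simp

lemma nn_integral_left_mult:
  assumes "g \<in> carrier G" and "f \<in> borel_measurable m"
  shows "(\<integral>\<^sup>+x. f (g \<otimes> x) \<partial>m) = (\<integral>\<^sup>+x. f x \<partial>m)"
proof -
  have "(\<integral>\<^sup>+x. f x \<partial>m) = (\<integral>\<^sup>+x. f x \<partial>distr m m (\<lambda>x. g \<otimes> x))"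
    by (simp add: distr_left_mult[OF assms(1)])
  also have "\<dots> = (\<integral>\<^sup>+x. f (g \<otimes> x) \<partial>m)"
    using assms by (intro nn_integral_distr) simp_all
  finally show ?thesis ..
qed

text \<open>
  The set of all pairs \<open>(y, x)\<close> with \<open>y x \<in> F\<close> and \<open>x\<^sup>-\<^sup>1 \<in> C\<close> is measured in two ways. Integrating over
  \<open>y\<close> first yields \<open>m(F x\<^sup>-\<^sup>1) = m(F)\<close> for each \<open>x \<in> C\<^sup>-\<^sup>1\<close>. Substituting \<open>y\<^sup>-\<^sup>1x\<close> for \<open>x\<close> first turns
  the conditions into \<open>x \<in> F\<close> and \<open>x\<^sup>-\<^sup>1y \<in> C\<close>, which has measure \<open>m(F) m(C)\<close>. It remains to cancel
  \<open>m(F)\<close>.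
\<close>

lemma emeasure_inverse:
  assumes C: "C \<in> sets m"
  shows "emeasure m {x \<in> carrier G. inv x \<in> C} = emeasure m C"
proof -
  interpret pair_sigma_finite m m ..
  note [measurable] = F_sets C
  define D where "D = {x \<in> carrier G. inv x \<in> C}"
  have [measurable]: "D \<in> sets m" unfolding D_def space_m[symmetric] by measurable
  have D_inv: "inv x \<in> D \<longleftrightarrow> x \<in> C" if "x \<in> carrier G" for x
    using that by (simp add: D_def)
  have "emeasure m F * emeasure m D = (\<integral>\<^sup>+x. emeasure m F * indicator D x \<partial>m)"
    by (simp add: nn_integral_cmult)
  also have "\<dots> = (\<integral>\<^sup>+x. (\<integral>\<^sup>+y. indicator F (y \<otimes> x) * indicator D x \<partial>m) \<partial>m)"
  proof (rule nn_integral_cong)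
    fix x assume "x \<in> space m"
    then have x: "x \<in> carrier G" by (simp add: space_m)
    have "(\<integral>\<^sup>+y. indicator F (y \<otimes> x) \<partial>m) = (\<integral>\<^sup>+y. indicator (F #> inv x) y \<partial>m)"
      using x by (intro nn_integral_cong)
        (auto simp: indicator_def r_coset_vimage sets_into_carrier[OF F_sets] space_m)
    also have "\<dots> = emeasure m F"
      using x F_sets r_coset_sets[of "inv x" F] emeasure_fundamental_r_coset[of "inv x"] by simp
    finally show "emeasure m F * indicator D x = (\<integral>\<^sup>+y. indicator F (y \<otimes> x) * indicator D x \<partial>m)"
      using x by (subst nn_integral_multc) measurable
  qed
  also have "\<dots> = (\<integral>\<^sup>+y. (\<integral>\<^sup>+x. indicator F (y \<otimes> x) * indicator D x \<partial>m) \<partial>m)"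
    by (rule Fubini') measurable
  \<comment> \<open>the substitution of \<open>y\<^sup>-\<^sup>1x\<close> for \<open>x\<close>\<close>
  also have "\<dots> = (\<integral>\<^sup>+y. (\<integral>\<^sup>+x. indicator F x * indicator D (inv y \<otimes> x) \<partial>m) \<partial>m)"
  proof (rule nn_integral_cong)
    fix y assume "y \<in> space m"
    then have y: "y \<in> carrier G" by (simp add: space_m)
    then have [measurable]: "(\<lambda>x. inv y) \<in> m \<rightarrow>\<^sub>M m" by simp
    have "(\<integral>\<^sup>+x. indicator F (y \<otimes> x) * indicator D x \<partial>m)
        = (\<integral>\<^sup>+x. indicator F (y \<otimes> x) * indicator D (inv y \<otimes> (y \<otimes> x)) \<partial>m)"
      using y by (intro nn_integral_cong) (simp add: m_assoc[symmetric] space_m)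
    also have "\<dots> = (\<integral>\<^sup>+x. indicator F x * indicator D (inv y \<otimes> x) \<partial>m)"
      by (rule nn_integral_left_mult[OF y]) measurable
    finally show "(\<integral>\<^sup>+x. indicator F (y \<otimes> x) * indicator D x \<partial>m)
        = (\<integral>\<^sup>+x. indicator F x * indicator D (inv y \<otimes> x) \<partial>m)" .
  qed
  also have "\<dots> = (\<integral>\<^sup>+x. (\<integral>\<^sup>+y. indicator F x * indicator D (inv y \<otimes> x) \<partial>m) \<partial>m)"
    by (rule Fubini') measurable
  also have "\<dots> = (\<integral>\<^sup>+x. (\<integral>\<^sup>+y. indicator F x * indicator C (inv x \<otimes> y) \<partial>m) \<partial>m)"
  proof (intro nn_integral_cong)
    fix x y assume xy: "x \<in> space m" "y \<in> space m"
    then have "inv (inv x \<otimes> y) \<in> D \<longleftrightarrow> inv x \<otimes> y \<in> C"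
      by (intro D_inv) (simp add: space_m)
    then have "inv y \<otimes> x \<in> D \<longleftrightarrow> inv x \<otimes> y \<in> C"
      using xy by (simp add: space_m inv_mult_group)
    then show "indicator F x * indicator D (inv y \<otimes> x) = (indicator F x * indicator C (inv x \<otimes> y) :: ennreal)"
      by (simp add: indicator_def)
  qed
  also have "\<dots> = (\<integral>\<^sup>+x. indicator F x * emeasure m C \<partial>m)"
  proof (rule nn_integral_cong)
    fix x assume "x \<in> space m"
    then have x: "inv x \<in> carrier G" by (simp add: space_m)
    have "(\<integral>\<^sup>+y. indicator F x * indicator C (inv x \<otimes> y) \<partial>m) = (\<integral>\<^sup>+y. indicator F x * indicator C y \<partial>m)"
      by (rule nn_integral_left_mult[OF x]) measurable
    then show "(\<integral>\<^sup>+y. indicator F x * indicator C (inv x \<otimes> y) \<partial>m) = indicator F x * emeasure m C"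
      by (simp add: nn_integral_cmult)
  qed
  also have "\<dots> = emeasure m F * emeasure m C"
    by (simp add: nn_integral_multc)
  finally show ?thesis
    using emeasure_F_nonzero F_finite by (auto simp: ennreal_mult_cancel_left D_def)
qed

text \<open>
  Inversion exchanges left and right translations, so a left-invariant measure that it preserves is
  right-invariant.
\<close>

lemma right_invariant:
  assumes h: "h \<in> carrier G" and A: "A \<in> sets m"
  shows "emeasure m {x \<in> carrier G. x \<otimes> h \<in> A} = emeasure m A"
proof -
  note [measurable] = A
  define B where "B = {x \<in> carrier G. inv x \<in> A}"
  have B: "B \<in> sets m" unfolding B_def space_m[symmetric] by measurable
  have B': "{x \<in> carrier G. inv h \<otimes> x \<in> B} \<in> sets m"
    using l_coset_sets[OF h B] l_coset_vimage[OF h sets_into_carrier[OF B]] by simp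
  have "{x \<in> carrier G. x \<otimes> h \<in> A} = {x \<in> carrier G. inv x \<in> {x \<in> carrier G. inv h \<otimes> x \<in> B}}"
    using h by (auto simp: B_def inv_mult_group)
  then have "emeasure m {x \<in> carrier G. x \<otimes> h \<in> A} = emeasure m {x \<in> carrier G. inv h \<otimes> x \<in> B}"
    using emeasure_inverse[OF B'] by simp
  also have "\<dots> = emeasure m B" using h B by (intro emeasure_left_mult_vimage) auto
  also have "\<dots> = emeasure m A" unfolding B_def by (rule emeasure_inverse[OF A])
  finally show ?thesis .
qed

text \<open>
  Right translation by \<open>h\<close> acts on \<open>\<Gamma>\G\<close>. Pulling \<open>A\<close> back along it amounts to measuring \<open>A\<close> on the
  fundamental domain \<open>F h\<close> in place of \<open>F\<close>.
\<close>

lemma translation_preserves_quotient_measure: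
  assumes h: "h \<in> carrier G" and A: "A \<in> sets m" "left_periodic A"
  shows "emeasure m {x \<in> F. x \<otimes> h \<in> A} = emeasure m (A \<inter> F)"
proof -
  have "{x \<in> F. x \<otimes> h \<in> A} = {x \<in> carrier G. x \<otimes> h \<in> A \<inter> (F #> h)}"
    using h sets_into_carrier[OF F_sets] by (auto simp: r_coset_vimage m_assoc)
  then have "emeasure m {x \<in> F. x \<otimes> h \<in> A} = emeasure m (A \<inter> (F #> h))"
    using right_invariant[OF h, of "A \<inter> (F #> h)"] h A F_sets by simp
  also have "\<dots> = emeasure m (A \<inter> F)"
    using fundamental_r_coset[OF fundamental_F h] fundamental_F A by (rule emeasure_fundamental_independent)
  finally show ?thesis .
qed

text \<open>
  A form of Poincare recurrence for the action of \<open>u\<close> on the finite measure space \<open>\<Gamma>\G\<close>. On the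
  invariant set of escaping points, let \<open>E R k\<close> consist of those at which \<open>f\<close> exceeds \<open>R\<close> from time
  \<open>k\<close> on. The \<open>k\<close>-th power of \<open>u\<close> carries \<open>E R k\<close> to \<open>E R 0\<close>, so all of them have the same measure, which must be
  that of their union over \<open>k\<close>, the whole escaping set. Thus \<open>f > R\<close> almost everywhere on the
  escaping set for each \<open>R\<close>; as \<open>f\<close> takes finite values, this set is null.
\<close>

lemma no_escape_to_infinity:
  fixes f :: "'a \<Rightarrow> real"
  assumes u: "u \<in> carrier G"
    and f [measurable]: "f \<in> borel_measurable m"
    and f_\<Gamma>: "\<And>\<gamma> x. \<gamma> \<in> \<Gamma> \<Longrightarrow> x \<in> carrier G \<Longrightarrow> f (\<gamma> \<otimes> x) = f x"
  shows "AE x in m. x \<in> F \<longrightarrow> \<not> filterlim (\<lambda>n::nat. f (x \<otimes> u [^] n)) at_top sequentially"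
proof -
  note [measurable] = F_sets
  have un [measurable]: "u [^] n \<in> carrier G" for n :: nat using u by simp
  define g where "g n x = f (x \<otimes> u [^] n)" for n :: nat and x
  have [measurable]: "g n \<in> borel_measurable m" for n
    unfolding g_def by (rule measurable_compose[OF _ f]) (intro mult_measurable' const_measurable un measurable_ident_sets refl)
  define Esc where "Esc = {x \<in> carrier G. \<forall>R::nat. \<exists>N. \<forall>n\<ge>N. g n x > real R}"
  have Esc_iff: "x \<in> Esc \<longleftrightarrow> filterlim (\<lambda>n. g n x) at_top sequentially" if "x \<in> carrier G" for x
  proof -
    have "filterlim (\<lambda>n. g n x) at_top sequentially
      \<longleftrightarrow> (\<forall>R::nat. \<forall>\<^sub>F n in sequentially. real R < g n x)" (is "?L \<longleftrightarrow> ?R")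
    proof
      show "?L \<Longrightarrow> ?R" unfolding filterlim_at_top_dense by blast
      assume ?R
      show ?L unfolding filterlim_at_top_dense
      proof
        fix Z :: real
        obtain R :: nat where R: "Z < real R" using reals_Archimedean2 by blast
        have "\<forall>\<^sub>F n in sequentially. real R < g n x" using \<open>?R\<close> by blast
        then show "\<forall>\<^sub>F n in sequentially. Z < g n x"
          by (rule eventually_mono) (use R in simp)
      qed
    qed
    then show ?thesis using that by (simp add: Esc_def eventually_sequentially)
  qed
  define E where "E R k = {x \<in> Esc. \<forall>n\<ge>k. g n x > real R}" for R k :: nat
  have Esc_sets [measurable]: "Esc \<in> sets m" unfolding Esc_def space_m[symmetric] by measurable
  have E_sets [measurable]: "E R k \<in> sets m" for R k
  proof -
    have "E R k = {x \<in> space m. x \<in> Esc \<and> (\<forall>n\<ge>k. g n x > real R)}"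
      using sets_into_carrier[OF Esc_sets] by (auto simp: E_def space_m)
    then show ?thesis by simp
  qed
  have shift: "g n (x \<otimes> u [^] k) = g (k + n) x" if "x \<in> carrier G" for x and k n :: nat
    using that u by (simp add: g_def m_assoc nat_pow_mult)
  have per: "g n (\<gamma> \<otimes> x) = g n x" if "\<gamma> \<in> \<Gamma>" "x \<in> carrier G" for \<gamma> x and n :: nat
    using that f_\<Gamma>[of \<gamma> "x \<otimes> u [^] n"] un[of n] \<Gamma>_carrier by (simp add: g_def m_assoc)
  have E_per: "left_periodic (E R k)" for R k
    using \<Gamma>_carrier by (auto simp: left_periodic_def E_def Esc_def per)
  have Esc_shift: "x \<otimes> u [^] k \<in> Esc \<longleftrightarrow> x \<in> Esc" if x: "x \<in> carrier G" for x and k :: nat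
  proof -
    have xk: "x \<otimes> u [^] k \<in> carrier G" using x un by simp
    show ?thesis
      unfolding Esc_iff[OF x] Esc_iff[OF xk] shift[OF x]
      unfolding filterlim_at_top_dense
      using eventually_sequentially_seg[of "\<lambda>n. _ < g n x" k] by (simp add: add.commute)
  qed
  have E_eq: "emeasure m (E R k \<inter> F) = emeasure m (E R 0 \<inter> F)" for R k
  proof -
    have "{x \<in> F. x \<otimes> u [^] k \<in> E R 0} = E R k \<inter> F"
      using sets_into_carrier[OF F_sets]
      by (auto simp: E_def Esc_shift shift subset_iff le_iff_add)
    then show ?thesis
      using translation_preserves_quotient_measure[OF un[of k] E_sets E_per, of R 0] by simp
  qed
  have Esc_E: "emeasure m (Esc \<inter> F) = emeasure m (E R 0 \<inter> F)" for R
  proof -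
    have "(\<Union>k. E R k \<inter> F) = Esc \<inter> F" by (auto simp: E_def Esc_def)
    moreover have "(SUP k. emeasure m (E R k \<inter> F)) = emeasure m (\<Union>k. E R k \<inter> F)"
      by (rule SUP_emeasure_incseq) (auto simp: incseq_def E_def)
    moreover have "(SUP k. emeasure m (E R k \<inter> F)) = (SUP k :: nat. emeasure m (E R 0 \<inter> F))"
      by (rule SUP_cong[OF refl E_eq])
    ultimately show ?thesis by simp
  qed
  have "(INF R. emeasure m (E R 0 \<inter> F)) = emeasure m (\<Inter>R. E R 0 \<inter> F)"
  proof (rule INF_emeasure_decseq)
    show "decseq (\<lambda>R. E R 0 \<inter> F)"
    proof (rule decseq_SucI)
      show "E (Suc R) 0 \<inter> F \<subseteq> E R 0 \<inter> F" for R
        unfolding E_def by (auto intro: less_trans[of "real R" "real (Suc R)"])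
    qed
    show "emeasure m (E R 0 \<inter> F) \<noteq> \<infinity>" for R
      using F_finite emeasure_mono[of "E R 0 \<inter> F" F m] by (auto simp: top_unique)
  qed auto
  moreover have "(\<Inter>R. E R 0 \<inter> F) = {}"
  proof -
    have False if "x \<in> (\<Inter>R. E R 0 \<inter> F)" for x
    proof -
      obtain R :: nat where "g 0 x < real R" using reals_Archimedean2 by blast
      moreover have "x \<in> E R 0" using that by blast
      then have "real R < g 0 x" unfolding E_def by blast
      ultimately show False by simp
    qed
    then show ?thesis by blast
  qed
  ultimately have "emeasure m (Esc \<inter> F) = 0"
    by (simp add: Esc_E[symmetric])
  then have "AE x in m. x \<notin> Esc \<inter> F"
    by (intro AE_not_in) (simp add: null_sets_def)
  then show ?thesis
    using AE_space by eventually_elim (auto simp: Esc_iff space_m g_def[abs_def])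
qed

end

section \<open>Generation of the special linear group by transvections\<close>

definition transvection :: "'n \<Rightarrow> 'n \<Rightarrow> real \<Rightarrow> real ^ 'n ^ 'n" where
  "transvection i j t = (\<chi> a b. of_bool (a = b) + (if a = i \<and> b = j then t else 0))"

definition single_diag :: "'n \<Rightarrow> real \<Rightarrow> real ^ 'n ^ 'n" where
  "single_diag k c = (\<chi> a b. if a = b then if a = k then c else 1 else 0)"

abbreviation transvections :: "(real ^ 'n ^ 'n) set" where
  "transvections \<equiv> {transvection i j t |i j t. i \<noteq> j}"

lemma transvection_vector:
  "transvection i j t *v x = (\<chi> a. x $ a + (if a = i then t * x $ j else 0))"
  by (simp add: transvection_def matrix_vector_mult_def vec_eq_iff distrib_right sum.distrib
      of_bool_def if_distrib[of "\<lambda>z. z * _"] cong: if_cong)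

lemma single_diag_vector:
  "single_diag k c *v x = (\<chi> a. if a = k then c * x $ a else x $ a)"
  by (simp add: single_diag_def matrix_vector_mult_def vec_eq_iff
      if_distrib[of "\<lambda>z. z * _"] cong: if_cong)

lemma transvection_0: "transvection i j 0 = mat 1"
  by (simp add: transvection_def mat_def vec_eq_iff)

lemma transvection_add:
  assumes "i \<noteq> j"
  shows "transvection i j s ** transvection i j t = transvection i j (s + t)"
  using assms by (simp add: matrix_eq matrix_vector_mul_assoc[symmetric] transvection_vector vec_eq_iff
      distrib_right)

lemma single_diag_1: "single_diag k 1 = mat 1"
  by (simp add: single_diag_def mat_def vec_eq_iff)

lemma single_diag_mult: "single_diag k c ** single_diag k d = single_diag k (c * d)"
  by (simp add: matrix_eq matrix_vector_mul_assoc[symmetric] single_diag_vector vec_eq_iff)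

lemma det_single_diag: "det (single_diag k c) = c"
  by (subst det_diagonal) (simp_all add: single_diag_def)

lemma det_transvection:
  assumes "i \<noteq> j" shows "det (transvection i j t) = 1"
proof -
  have "transvection i j t = (\<chi> k. if k = i then row i (mat 1) + t *s row j (mat 1) else row k (mat 1))"
    by (simp add: transvection_def row_def mat_def vec_eq_iff of_bool_def)
  then show ?thesis using det_row_operation[OF assms, of "mat 1" t] by simp
qed

lemma transvections_SL: "transvections \<subseteq> carrier SL"
  by (auto simp: SL_def det_transvection)

lemma generate_transvections_mult:
  "A \<in> generate SL transvections \<Longrightarrow> B \<in> generate SL transvections \<Longrightarrow> A ** B \<in> generate SL transvections"
  using generate.eng[of A SL transvections B] by (simp add: SL_def)

lemma generate_transvections_det: "A \<in> generate SL transvections \<Longrightarrow> det A = 1"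
  using group.generate_in_carrier[OF group_SL transvections_SL] by (auto simp: SL_def)

lemma transvection_generate: "i \<noteq> j \<Longrightarrow> transvection i j t \<in> generate SL transvections"
  by (rule generate.incl) blast

lemma SL_inv_transvection:
  assumes "i \<noteq> j"
  shows "inv\<^bsub>SL\<^esub> (transvection i j t) = transvection i j (- t)"
  by (rule group.inv_equality[OF group_SL])
    (use assms in \<open>auto simp: SL_def det_transvection transvection_add transvection_0\<close>)

text \<open>
  Conjugation by a diagonal matrix rescales the parameter of a transvection.
\<close>

lemma single_diag_normalizes:
  fixes h :: "real ^ 'n ^ 'n"
  assumes "h \<in> generate SL transvections" "c \<noteq> 0"
  shows "\<exists>h'\<in>generate SL transvections. single_diag k c ** h = h' ** single_diag k c"
proof -
  have tv: "\<exists>h'\<in>generate SL transvections. single_diag k c ** transvection i j t = h' ** single_diag k c"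
    if "i \<noteq> j" for i j t
  proof
    show "single_diag k c ** transvection i j t =
        transvection i j ((if i = k then c else 1) * t / (if j = k then c else 1)) ** single_diag k c"
      using that assms(2)
      by (simp add: matrix_eq matrix_vector_mul_assoc[symmetric] transvection_vector single_diag_vector
          vec_eq_iff distrib_left)
  qed (rule transvection_generate[OF that])
  show ?thesis
    using assms(1)
  proof induction
    case one
    show ?case by (rule bexI[OF _ generate.one]) (simp add: SL_def)
  next
    case (incl h)
    then show ?case using tv by blast
  next
    case (inv h)
    then obtain i j t where ij: "i \<noteq> j" and "h = transvection i j t" by blast
    then show ?case using tv[OF ij] by (simp add: SL_inv_transvection)
  next
    case (eng h1 h2)
    then obtain h1' h2' where *: "h1' \<in> generate SL transvections" "h2' \<in> generate SL transvections"
      "single_diag k c ** h1 = h1' ** single_diag k c" "single_diag k c ** h2 = h2' ** single_diag k c"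
      by blast
    have "single_diag k c ** (h1 ** h2) = (h1' ** h2') ** single_diag k c"
      by (metis *(3,4) matrix_mul_assoc)
    then show ?case using generate_transvections_mult[OF *(1,2)] by (auto simp: SL_def)
  qed
qed

lemma antidiagonal_generate:
  assumes "i \<noteq> j" "t \<noteq> 0"
  shows "transvection i j t ** transvection j i (- inverse t) ** transvection i j t \<in> generate SL transvections"
  using assms by (intro generate_transvections_mult transvection_generate) auto

text \<open>
  This product acts on the plane of the coordinates \<open>i\<close> and \<open>j\<close> as the matrix with rows \<open>(0, t)\<close> and
  \<open>(-1/t, 0)\<close>. Such matrices give the diagonal matrices of determinant \<open>1\<close> and, up to a
  sign, the transpositions.
\<close>

lemma antidiagonal_vector:
  assumes "i \<noteq> j" "t \<noteq> 0"
  shows "(transvection i j t ** transvection j i (- inverse t) ** transvection i j t) *v x =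
    (\<chi> a. if a = i then t * x $ j else if a = j then - inverse t * x $ i else x $ a)"
  using assms by (simp add: matrix_vector_mul_assoc[symmetric] transvection_vector vec_eq_iff
      distrib_left right_diff_distrib mult.assoc[symmetric])

lemma transposition_vector:
  "(\<chi> a b. mat 1 $ a $ Transposition.transpose i j b) *v x = (\<chi> a. x $ Transposition.transpose i j a)"
  for x :: "real ^ 'n"
proof -
  have "(mat 1 :: real ^ 'n ^ 'n) $ a $ Transposition.transpose i j b =
      (if b = Transposition.transpose i j a then 1 else 0)" for a b
    by (auto simp: mat_def)
  then show ?thesis
    by (simp add: matrix_vector_mult_def vec_eq_iff if_distrib[of "\<lambda>z. z * _"] cong: if_cong)
qed

text \<open>
  Gaussian elimination, with the determinant collected in one diagonal entry \<open>k\<close> chosen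
  beforehand. In this form the property passes to products, since \<open>single_diag k c\<close> normalizes the
  group of transvections, and it only has to be verified for elementary matrices.
\<close>

lemma elementary_factorization:
  fixes A :: "real ^ 'n ^ 'n"
  shows "det A \<noteq> 0 \<Longrightarrow> \<exists>h\<in>generate SL transvections. A = h ** single_diag k (det A)"
proof -
  let ?H = "generate SL transvections :: (real ^ 'n ^ 'n) set"
  define P where "P A \<longleftrightarrow> (det A \<noteq> 0 \<longrightarrow> (\<exists>h\<in>?H. A = h ** single_diag k (det A)))" for A :: "real ^ 'n ^ 'n"
  have PI: "P A" if "h \<in> ?H" "A = h ** single_diag k c" for A h c
  proof -
    have "det A = c" using that by (simp add: det_mul det_single_diag generate_transvections_det)
    then show ?thesis using that unfolding P_def by blast
  qed
  have mult: "P (A ** B)" if "P A" "P B" for A B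
  proof (cases "det A = 0 \<or> det B = 0")
    case True
    then show ?thesis by (auto simp: P_def det_mul)
  next
    case False
    then obtain h1 h2 where h: "h1 \<in> ?H" "h2 \<in> ?H"
      "A = h1 ** single_diag k (det A)" "B = h2 ** single_diag k (det B)"
      using \<open>P A\<close> \<open>P B\<close> unfolding P_def by blast
    obtain h2' where h2': "h2' \<in> ?H" "single_diag k (det A) ** h2 = h2' ** single_diag k (det A)"
      using single_diag_normalizes[OF h(2)] False by blast
    have "A ** B = (h1 ** h2') ** single_diag k (det A * det B)"
      by (metis h(3,4) h2'(2) matrix_mul_assoc single_diag_mult)
    then show ?thesis using PI generate_transvections_mult[OF h(1) h2'(1)] by blast
  qed
  have P_mat_1: "P (mat 1)"
    using PI[OF generate.one, of _ 1] by (simp add: single_diag_1 SL_def)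
  have single: "P (single_diag i c)" for i c
  proof (cases "c = 0 \<or> i = k")
    case True
    then show ?thesis
      using PI[OF generate.one, of _ c] by (auto simp: P_def det_single_diag SL_def)
  next
    case False
    let ?w = "\<lambda>t. transvection i k t ** transvection k i (- inverse t) ** transvection i k t"
    have w: "?w t \<in> ?H" if "t \<noteq> 0" for t
      using False that by (intro antidiagonal_generate) auto
    \<comment> \<open>The two antidiagonal factors multiply to \<open>c\<close> at \<open>i\<close> and \<open>1/c\<close> at \<open>k\<close>, which moves the entry \<open>c\<close> from \<open>k\<close> to \<open>i\<close>.\<close>
    have eq: "single_diag i c = (?w c ** ?w (- 1)) ** single_diag k c"
      unfolding matrix_eq
    proof
      fix x :: "real ^ 'n"
      have "((?w c ** ?w (- 1)) ** single_diag k c) *v x = ?w c *v (?w (- 1) *v (single_diag k c *v x))"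
        by (simp only: matrix_vector_mul_assoc matrix_mul_assoc)
      also have "\<dots> = single_diag i c *v x"
        using False by (subst (1 2) antidiagonal_vector) (auto simp: single_diag_vector vec_eq_iff)
      finally show "single_diag i c *v x = ((?w c ** ?w (- 1)) ** single_diag k c) *v x" ..
    qed
    have "?w c ** ?w (- 1) \<in> ?H"
    proof (rule generate_transvections_mult)
      show "?w c \<in> ?H" using False by (intro w) blast
      show "?w (- 1) \<in> ?H" by (rule w) simp
    qed
    then show ?thesis using eq by (rule PI)
  qed
  have diagonal: "P A" if A: "\<And>i j. i \<noteq> j \<Longrightarrow> A $ i $ j = 0" for A
  proof -
    have "P (\<chi> a b. if a = b then if a \<in> S then A $ a $ a else 1 else 0)" if "finite S" for S
      using that
    proof (induction S)
      case empty
      show ?case using P_mat_1 by (simp add: mat_def cong: if_cong)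
    next
      case (insert i S)
      have "(\<chi> a b. if a = b then if a \<in> insert i S then A $ a $ a else 1 else 0) =
          single_diag i (A $ i $ i) ** (\<chi> a b. if a = b then if a \<in> S then A $ a $ a else 1 else 0)"
        using insert.hyps
        by (auto simp: vec_eq_iff matrix_matrix_mult_def single_diag_def if_distrib[of "\<lambda>z. z * _"] cong: if_cong)
      then show ?case using mult[OF single insert.IH] by simp
    qed
    from this[of UNIV] have "P (\<chi> a b. if a = b then A $ a $ a else 0)" by (simp cong: if_cong)
    also have "(\<chi> a b. if a = b then A $ a $ a else 0) = A" using A by (simp add: vec_eq_iff)
    finally show ?thesis .
  qed
  have "P A"
  proof (induction A rule: induct_matrix_elementary)
    case (1 A B)
    then show ?case by (rule mult)
  next
    case (2 A i)
    then show ?case by (simp add: P_def det_zero_row)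
  next
    case (3 A)
    then show ?case by (rule diagonal)
  next
    case (4 i j)
    have "(\<chi> a b. mat 1 $ a $ Transposition.transpose i j b) =
        (transvection i j 1 ** transvection j i (- inverse 1) ** transvection i j 1) ** single_diag i (- 1)"
      unfolding matrix_eq matrix_vector_mul_assoc[symmetric, of _ "single_diag i (- 1)"]
        antidiagonal_vector[OF 4 one_neq_zero] transposition_vector single_diag_vector
      using 4 by (auto simp: vec_eq_iff Transposition.transpose_def)
    moreover have "P (transvection i j 1 ** transvection j i (- inverse 1) ** transvection i j 1)"
      by (rule PI[OF antidiagonal_generate[OF 4 one_neq_zero], of _ 1]) (simp only: single_diag_1 matrix_mul_rid)
    ultimately show ?case using mult[OF _ single] by metis
  next
    case (5 i j c)
    have "(\<chi> a b. if a = i \<and> b = j then c else of_bool (a = b)) = transvection i j c"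
      using 5 by (auto simp: transvection_def vec_eq_iff)
    then show ?case
      using PI[OF transvection_generate[OF 5], of _ c 1] by (simp add: single_diag_1)
  qed
  then show "det A \<noteq> 0 \<Longrightarrow> ?thesis" by (simp add: P_def)
qed

theorem SL_generated_by_transvections: "carrier SL = generate SL transvections"
proof
  show "carrier SL \<subseteq> generate SL (transvections :: (real ^ 'n ^ 'n) set)"
  proof
    fix A :: "real ^ 'n ^ 'n" assume "A \<in> carrier SL"
    then have "det A = 1" by (simp add: SL_def)
    then show "A \<in> generate SL transvections"
      using elementary_factorization[of A] by (auto simp: single_diag_1)
  qed
qed (auto simp: SL_def generate_transvections_det)

section \<open>Special linear groups and their lattices\<close>

text \<open>
  Each point of a discrete set is isolated from the others by a member of a fixed countable basis.
\<close>

lemma discrete_imp_countable: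
  fixes S :: "'a::second_countable_topology set"
  assumes "discrete S"
  shows "countable S"
proof -
  obtain \<B> :: "'a set set" where \<B>: "countable \<B>" "topological_basis \<B>"
    using ex_countable_basis by blast
  have "\<exists>B\<in>\<B>. B \<inter> S = {x}" if xS: "x \<in> S" for x
  proof -
    obtain T where T: "open T" "T \<inter> S = {x}"
      using assms xS by (auto simp: discrete_def isolated_in_def)
    then have "x \<in> T" by blast
    then obtain B where "B \<in> \<B>" "x \<in> B" "B \<subseteq> T" using topological_basisE[OF \<B>(2) T(1)] by blast
    then show ?thesis using T(2) by blast
  qed
  then obtain b where b: "\<And>x. x \<in> S \<Longrightarrow> b x \<in> \<B> \<and> b x \<inter> S = {x}" by metis
  then have "inj_on b S" by (metis inj_onI singleton_inject)
  moreover have "b ` S \<subseteq> \<B>" using b by blast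
  ultimately show ?thesis using \<B>(1) countable_subset countable_image_inj_on by metis
qed

lemma continuous_on_matrix_mult:
  "continuous_on UNIV (\<lambda>p. fst p ** snd p :: real ^ 'n ^ 'n)"
  unfolding matrix_matrix_mult_def by (intro continuous_intros)

text \<open>
  Cramer's rule: it exhibits the entries of the inverse as polynomials in those of \<open>A\<close>, whence
  inversion is continuous.
\<close>

lemma SL_inv_entry:
  fixes A :: "real ^ 'n ^ 'n"
  assumes "A \<in> carrier SL"
  shows "(inv\<^bsub>SL\<^esub> A) $ i $ k = det (\<chi> a b. if b = i then axis k 1 $ a else A $ a $ b)"
proof -
  have det: "det A = 1" using assms by (simp add: SL_def)
  have "A ** (inv\<^bsub>SL\<^esub> A) = mat 1"
    using group.r_inv[OF group_SL assms] by (simp add: SL_def)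
  then have "A *v ((inv\<^bsub>SL\<^esub> A) *v axis k 1) = axis k 1"
    by (simp add: matrix_vector_mul_assoc)
  then have "(inv\<^bsub>SL\<^esub> A) *v axis k 1 = (\<chi> i. det (\<chi> a b. if b = i then axis k 1 $ a else A $ a $ b) / det A)"
    using cramer[of A] det by simp
  moreover have "((inv\<^bsub>SL\<^esub> A) *v axis k 1) $ i = (inv\<^bsub>SL\<^esub> A) $ i $ k"
    by (simp add: matrix_vector_mult_basis column_def)
  ultimately show ?thesis using det by simp
qed

lemma continuous_on_SL_inv:
  "continuous_on (carrier SL) (\<lambda>A :: real ^ 'n ^ 'n. inv\<^bsub>SL\<^esub> A)"
proof -
  have entry: "continuous_on (carrier SL) (\<lambda>A :: real ^ 'n ^ 'n. (if b = i then axis k 1 $ a else A $ a $ b))"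
    for a b i k by (cases "b = i") (auto intro!: continuous_intros)
  have "continuous_on (carrier SL) (\<lambda>A :: real ^ 'n ^ 'n. \<chi> i k. (inv\<^bsub>SL\<^esub> A) $ i $ k)"
  proof (intro continuous_on_vec_lambda)
    fix i k
    have "continuous_on (carrier SL)
        (\<lambda>A :: real ^ 'n ^ 'n. det (\<chi> a b. if b = i then axis k 1 $ a else A $ a $ b))"
      unfolding det_def using entry by (simp, intro continuous_intros) 
    then show "continuous_on (carrier SL) (\<lambda>A :: real ^ 'n ^ 'n. (inv\<^bsub>SL\<^esub> A) $ i $ k)"
      by (rule continuous_on_eq) (simp add: SL_inv_entry)
  qed
  then show ?thesis by simp
qed

lemma discrete_lattice_SL_domain:
  fixes \<Gamma> :: "(real ^ 'd ^ 'd) set"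
  assumes "discrete_lattice SL \<Gamma>"
  obtains m F where "group_with_fundamental_domain SL m \<Gamma> F"
    "sets m = sets (restrict_space borel (carrier SL))"
proof -
  obtain m :: "(real ^ 'd ^ 'd) measure" and F where
    haar: "left_haar_measure SL m" and F: "F \<in> sets m" "carrier SL = (\<Union>\<gamma>\<in>\<Gamma>. \<gamma> <#\<^bsub>SL\<^esub> F)"
       "disjoint_family_on (\<lambda>\<gamma>. \<gamma> <#\<^bsub>SL\<^esub> F) \<Gamma>" "emeasure m F < \<infinity>"
    and \<Gamma>: "subgroup \<Gamma> SL" "discrete \<Gamma>"
    using assms unfolding discrete_lattice_def by blast
  have left_inv: "emeasure m (g <#\<^bsub>SL\<^esub> A) = emeasure m A" if "g \<in> carrier SL" "A \<in> sets m" for g A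
    using haar that by (simp add: left_haar_measure_def)
  have nz: "emeasure m (carrier SL) \<noteq> 0"
    using haar by (simp add: left_haar_measure_def)
  let ?R = "restrict_space borel (carrier SL) :: (real ^ 'd ^ 'd) measure"
  have sets: "sets m = sets ?R" using haar by (simp add: left_haar_measure_def)
  then have space: "space m = carrier SL"
    using sets_eq_imp_space_eq[OF sets] by (simp add: space_restrict_space)
  have incl: "(\<lambda>x. x) \<in> borel_measurable m"
    unfolding measurable_cong_sets[OF sets refl] by (intro measurable_restrict_space1) simp
  have into: "f \<in> M \<rightarrow>\<^sub>M m" if "f \<in> borel_measurable M" "f \<in> space M \<rightarrow> carrier SL" for f and M :: "'z measure"
    unfolding measurable_cong_sets[OF refl sets] using that by (intro measurable_restrict_space2)
  have "group_with_fundamental_domain SL m \<Gamma> F"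
  proof (intro group_with_fundamental_domain.intro group_with_fundamental_domain_axioms.intro)
    have "(\<lambda>p. fst p ** snd p) \<in> borel_measurable (m \<Otimes>\<^sub>M m)"
      by (rule borel_measurable_continuous_Pair[OF _ _ continuous_on_matrix_mult])
        (rule measurable_compose[OF measurable_fst incl] measurable_compose[OF measurable_snd incl])+
    then have "(\<lambda>p. fst p ** snd p) \<in> m \<Otimes>\<^sub>M m \<rightarrow>\<^sub>M m"
      by (rule into) (auto simp: space_pair_measure space SL_def det_mul)
    then show "(\<lambda>(x, y). x \<otimes>\<^bsub>SL\<^esub> y) \<in> m \<Otimes>\<^sub>M m \<rightarrow>\<^sub>M m"
      by (simp add: SL_def case_prod_beta')
    have "(\<lambda>x. inv\<^bsub>SL\<^esub> x) \<in> borel_measurable m"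
      unfolding measurable_cong_sets[OF sets refl]
      by (rule borel_measurable_continuous_on_restrict[OF continuous_on_SL_inv])
    then show "(\<lambda>x. inv\<^bsub>SL\<^esub> x) \<in> m \<rightarrow>\<^sub>M m"
      by (rule into) (auto simp: space intro: group.inv_closed[OF group_SL])
  qed (fact group_SL space left_inv nz \<Gamma>(1) discrete_imp_countable[OF \<Gamma>(2)] F)+
  then show ?thesis using that sets by blast
qed

section \<open>Polynomial representations along transvections\<close>

lemma continuous_on_polynomial_in_entries:
  assumes "polynomial_in_entries_on X f"
  shows "continuous_on X f"
proof -
  obtain S c where f: "\<forall>g\<in>X. f g = (\<Sum>\<alpha>\<in>S. c \<alpha> * (\<Prod>i\<in>UNIV. \<Prod>j\<in>UNIV. complex_of_real (g $ i $ j) ^ \<alpha> i j))"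
    using assms unfolding polynomial_in_entries_on_def by blast
  have "continuous_on X (\<lambda>g. \<Sum>\<alpha>\<in>S. c \<alpha> * (\<Prod>i\<in>UNIV. \<Prod>j\<in>UNIV. complex_of_real (g $ i $ j) ^ \<alpha> i j))"
    by (intro continuous_intros)
  then show ?thesis by (rule continuous_on_eq) (use f in simp)
qed

lemma polynomial_in_entries_transvection:
  assumes f: "polynomial_in_entries_on (carrier SL) f" and ij: "i \<noteq> j"
  shows "\<exists>p. \<forall>t. f (transvection i j t) = poly p (complex_of_real t)"
proof -
  obtain S c where f: "\<forall>g\<in>carrier SL. f g = (\<Sum>\<alpha>\<in>S. c \<alpha> * (\<Prod>a\<in>UNIV. \<Prod>b\<in>UNIV. complex_of_real (g $ a $ b) ^ \<alpha> a b))"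
    using f unfolding polynomial_in_entries_on_def by blast
  define q where "q a b = [:of_bool (a = b), of_bool (a = i \<and> b = j) :: complex:]" for a b
  have q: "complex_of_real (transvection i j t $ a $ b) = poly (q a b) (complex_of_real t)" for t a b
    by (simp add: transvection_def q_def)
  have "transvection i j t \<in> carrier SL" for t using transvections_SL ij by blast
  then have "f (transvection i j t) = poly (\<Sum>\<alpha>\<in>S. smult (c \<alpha>) (\<Prod>a\<in>UNIV. \<Prod>b\<in>UNIV. q a b ^ \<alpha> a b)) (complex_of_real t)" for t
    using f by (simp add: poly_sum poly_prod q)
  then show ?thesis by blast
qed

text \<open>
  A nonconstant complex polynomial tends to infinity in modulus, so one nonconstant coordinate
  suffices to drive the curve to infinity.
\<close>

lemma polynomial_vector_curve_dichotomy:
  fixes z :: "real \<Rightarrow> complex ^ 'N"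
  assumes "\<And>k. \<exists>p. \<forall>t. z t $ k = poly p (complex_of_real t)"
  shows "(\<forall>t. z t = z 0) \<or> filterlim (\<lambda>n::nat. norm (z (real n))) at_top sequentially"
proof -
  obtain p where p: "\<And>k t. z t $ k = poly (p k) (complex_of_real t)" using assms by metis
  show ?thesis
  proof (cases "\<forall>k. degree (p k) = 0")
    case True
    then have "z t $ k = z 0 $ k" for t k using p by (metis degree_0_id poly_pCons poly_0 mult_zero_right degree_eq_zeroE)
    then show ?thesis by (simp add: vec_eq_iff)
  next
    case False
    then obtain k where "degree (p k) \<noteq> 0" by blast
    moreover obtain a q where aq: "p k = pCons a q" by (rule pCons_cases)
    ultimately have q: "q \<noteq> 0" by auto
    have "filterlim (\<lambda>n::nat. norm (z (real n))) at_top sequentially"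
      unfolding filterlim_at_top
    proof
      fix Z :: real
      obtain r where r: "\<forall>x. r \<le> cmod x \<longrightarrow> Z \<le> cmod (poly (pCons a q) x)"
        using poly_infinity[OF q] by blast
      have "\<forall>\<^sub>F n::nat in sequentially. r \<le> real n"
        using filterlim_real_sequentially by (simp add: filterlim_at_top)
      then show "\<forall>\<^sub>F n in sequentially. Z \<le> norm (z (real n))"
      proof (rule eventually_mono)
        fix n :: nat assume "r \<le> real n"
        then have "Z \<le> norm (z (real n) $ k)" using r p aq by simp
        also have "\<dots> \<le> norm (z (real n))" by (rule Finite_Cartesian_Product.norm_nth_le)
        finally show "Z \<le> norm (z (real n))" .
      qed
    qed
    then show ?thesis ..
  qed
qed

lemma SL_pow_transvection:
  assumes "i \<noteq> j"
  shows "transvection i j t [^]\<^bsub>SL\<^esub> (n::nat) = transvection i j (real n * t)"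
proof (induction n)
  case 0
  then show ?case by (simp add: SL_def transvection_0)
next
  case (Suc n)
  then show ?case using assms by (simp add: nat_pow_def) (simp add: SL_def transvection_add algebra_simps)
qed

section \<open>Vectors fixed by a lattice\<close>

theorem theorem7p1:
  fixes \<Gamma> :: "(real ^ 'd ^ 'd) set"
    and \<rho> :: "real ^ 'd ^ 'd \<Rightarrow> complex ^ 'N ^ 'N"
    and v :: "complex ^ 'N"
  assumes "discrete_lattice SL \<Gamma>"
    and "polynomial_representation_SL \<rho>"
    and "\<forall>\<gamma>\<in>\<Gamma>. \<rho> \<gamma> *v v = v"
  shows "\<forall>g\<in>carrier SL. \<rho> g *v v = v"
proof -
  obtain m F where domain: "group_with_fundamental_domain SL m \<Gamma> F"
    and sets_m: "sets m = sets (restrict_space borel (carrier SL))"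
    using discrete_lattice_SL_domain[OF assms(1)] by blast
  interpret group_with_fundamental_domain SL m \<Gamma> F by (rule domain)
  have hom: "\<rho> \<in> hom SL GL" and pol: "\<And>i j. polynomial_in_entries_on (carrier SL) (\<lambda>g. \<rho> g $ i $ j)"
    using assms(2) by (auto simp: polynomial_representation_SL_def)
  have \<rho>_mult: "\<rho> (g \<otimes>\<^bsub>SL\<^esub> h) *v w = \<rho> g *v (\<rho> h *v w)" if "g \<in> carrier SL" "h \<in> carrier SL" for g h w
    using hom_mult[OF hom that] by (simp add: GL_def matrix_vector_mul_assoc)
  have \<rho>_one: "\<rho> \<one>\<^bsub>SL\<^esub> = mat 1"
    using hom_one[OF hom group_SL group_GL] by (simp add: GL_def)
  \<comment> \<open>the orbit map, which descends to \<open>\<Gamma>\G\<close> because \<open>v\<close> is fixed by \<open>\<Gamma>\<close>\<close>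
  define \<phi> where "\<phi> g = \<rho> (inv\<^bsub>SL\<^esub> g) *v v" for g
  have \<phi>_mult: "\<phi> (g \<otimes>\<^bsub>SL\<^esub> h) = \<rho> (inv\<^bsub>SL\<^esub> h) *v \<phi> g" if "g \<in> carrier SL" "h \<in> carrier SL" for g h
    using that by (simp add: \<phi>_def inv_mult_group \<rho>_mult)
  have \<phi>_\<Gamma>: "\<phi> (\<gamma> \<otimes>\<^bsub>SL\<^esub> g) = \<phi> g" if "\<gamma> \<in> \<Gamma>" "g \<in> carrier SL" for \<gamma> g
    using that assms(3) \<Gamma>_carrier[OF that(1)] \<Gamma>_inv[OF that(1)] by (simp add: \<phi>_def inv_mult_group \<rho>_mult)
  have "continuous_on (carrier SL) (\<lambda>g. \<chi> i j. \<rho> g $ i $ j)"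
    by (intro continuous_on_vec_lambda continuous_on_polynomial_in_entries pol)
  then have "continuous_on (carrier SL) (\<lambda>g. \<rho> (inv\<^bsub>SL\<^esub> g))"
    by (intro continuous_on_compose2[OF _ continuous_on_SL_inv, of "carrier SL" \<rho>]) auto
  then have "continuous_on (carrier SL) (\<lambda>g. norm (\<phi> g))"
    unfolding \<phi>_def matrix_vector_mult_def by (intro continuous_intros)
  then have \<phi>_meas: "(\<lambda>g. norm (\<phi> g)) \<in> borel_measurable m"
    unfolding measurable_cong_sets[OF sets_m refl] by (rule borel_measurable_continuous_on_restrict)
  have fixed: "AE x in m. x \<in> F \<longrightarrow> (\<forall>t. \<rho> (transvection i j t) *v \<phi> x = \<phi> x)" if ij: "i \<noteq> j" for i j
  proof -
    \<comment> \<open>The sign makes \<open>\<phi> (x u\<^sup>n)\<close> the value of \<open>\<rho> (transvection i j t) *v \<phi> x\<close> at \<open>t = n\<close>.\<close>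
    define u where "u = transvection i j (- 1)"
    have u: "u \<in> carrier SL" using ij transvections_SL by (auto simp: u_def)
    have "AE x in m. x \<in> F \<longrightarrow> \<not> filterlim (\<lambda>n::nat. norm (\<phi> (x \<otimes>\<^bsub>SL\<^esub> u [^]\<^bsub>SL\<^esub> n))) at_top sequentially"
      using \<phi>_\<Gamma> by (intro no_escape_to_infinity[OF u \<phi>_meas]) simp
    then show ?thesis
    proof (rule AE_mp, intro AE_I2 impI allI)
      fix x t assume x: "x \<in> F" and
        *: "x \<in> F \<longrightarrow> \<not> filterlim (\<lambda>n::nat. norm (\<phi> (x \<otimes>\<^bsub>SL\<^esub> u [^]\<^bsub>SL\<^esub> n))) at_top sequentially"
      have xG: "x \<in> carrier SL" using x sets_into_carrier[OF F_sets] by blast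
      define z where "z t = \<rho> (transvection i j t) *v \<phi> x" for t
      have orbit: "\<phi> (x \<otimes>\<^bsub>SL\<^esub> u [^]\<^bsub>SL\<^esub> n) = z (real n)" for n :: nat
        using xG u ij \<phi>_mult[OF xG nat_pow_closed[OF u]]
        by (simp add: z_def u_def SL_pow_transvection SL_inv_transvection)
      have "\<exists>p. \<forall>t. z t $ k = poly p (complex_of_real t)" for k
      proof -
        obtain p where p: "\<And>l t. \<rho> (transvection i j t) $ k $ l = poly (p l) (complex_of_real t)"
          using polynomial_in_entries_transvection[OF pol ij] by metis
        have "z t $ k = poly (\<Sum>l\<in>UNIV. smult (\<phi> x $ l) (p l)) (complex_of_real t)" for t
          by (simp add: z_def matrix_vector_mult_def p poly_sum mult.commute)
        then show ?thesis by blast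
      qed
      then have "z t = z 0"
        using polynomial_vector_curve_dichotomy[of z] * x unfolding orbit by blast
      moreover have "z 0 = \<phi> x" using \<rho>_one by (simp add: z_def transvection_0 SL_def)
      ultimately show "\<rho> (transvection i j t) *v \<phi> x = \<phi> x" by (simp add: z_def)
    qed
  qed
  have AE_fixed: "AE x in m. \<forall>i j. i \<noteq> j \<longrightarrow> x \<in> F \<longrightarrow> (\<forall>t. \<rho> (transvection i j t) *v \<phi> x = \<phi> x)"
    using fixed by (intro eventually_all_finite) simp
  have "\<exists>x. x \<in> F \<and> (\<forall>i j t. i \<noteq> j \<longrightarrow> \<rho> (transvection i j t) *v \<phi> x = \<phi> x)"
  proof (rule ccontr)
    assume no: "\<not> ?thesis"
    have "AE x in m. x \<notin> F"
      using AE_fixed by (rule eventually_mono) (use no in blast)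
    then show False
      by (simp add: AE_iff_null_sets[OF F_sets, symmetric] null_sets_def emeasure_F_nonzero)
  qed
  then obtain x where x: "x \<in> F" "\<And>i j t. i \<noteq> j \<Longrightarrow> \<rho> (transvection i j t) *v \<phi> x = \<phi> x"
    by blast
  have xG: "x \<in> carrier SL" using x(1) sets_into_carrier[OF F_sets] by blast
  have invariant: "\<rho> h *v \<phi> x = \<phi> x" if "h \<in> carrier SL" for h
    using that unfolding SL_generated_by_transvections
  proof induction
    case one
    then show ?case by (simp add: \<rho>_one)
  next
    case (incl h)
    then show ?case using x(2) by blast
  next
    case (inv h)
    then show ?case using x(2) by (auto simp: SL_inv_transvection)
  next
    case (eng h1 h2)
    then have "h1 \<in> carrier SL" "h2 \<in> carrier SL" unfolding SL_generated_by_transvections by blast+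
    then show ?case using eng.IH by (simp add: \<rho>_mult)
  qed
  \<comment> \<open>The invariant vector is \<open>\<phi> x = \<rho> (x\<^sup>-\<^sup>1) v\<close>, so applying \<open>x\<close> itself identifies it with \<open>v\<close>.\<close>
  have "\<rho> x *v \<phi> x = v"
    using \<rho>_mult[OF xG inv_closed[OF xG], of v] xG by (simp add: \<phi>_def \<rho>_one)
  then have "\<phi> x = v" using invariant[OF xG] by simp
  then show ?thesis using invariant by simp
qed

end
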